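(* The following statements hold. (i) For $K\ge5$ and $\epsilon>0$, $$\sup\ \mathbb P\left(\frac1n\sum_{i=1}^I\sum_{j=1}^{n_i}\left(\sum_{k=1}^K z_{jk}^{(i)}\log\bar p_k^{(i)}-\sum_{k=1}^K p_{jk}^{(i)}\log\bar p_k^{(i)}\right)\ge\epsilon\right)\le\exp\left(-\frac{n\epsilon^2}{4(\log K)^2}\right).$$ (ii) Let $b^*=1/\min\left\{\frac1{\log K},\frac{\log K+2/K-2}{(1-1/K)\log K}\right\}$. For $K\ge5$ and $\epsilon>0$, $$\sup\ \mathbb P\left(\frac1n\sum_{i=1}^I\sum_{j=1}^{n_i}\left(\sum_{k=1}^K z_{jk}^{(i)}\log\bar p_k^{(i)}-\sum_{k=1}^K p_{jk}^{(i)}\log\bar p_k^{(i)}\right)\le-\epsilon\right)$$ is at most $\exp\left(-\frac{n\epsilon^2}{4(\log K)^2}\right)$ if $0<\epsilon\le\frac{2(\log K)^2}{b^*}$, and at most $\exp\left(-\frac{n\epsilon}{2b^*}\right)$ if $\epsilon>\frac{2(\log K)^2}{b^*}$. (iii) Let $K=K_n\ge2$ depend on $n$. If $(\log K_n)^2/n=\Omega(1)$ as $n\to\infty$, then for all $\epsilon>0$, $$\sup\ \mathbb P\left(\left|\frac1n\sum_{i=1}^I\sum_{j=1}^{n_i}\left(\sum_{k=1}^K z_{jk}^{(i)}\log\bar p_k^{(i)}-\sum_{k=1}^K p_{jk}^{(i)}\log\bar p_k^{(i)}\right)\right|\ge\epsilon\right)\not\to0\quad\text{as }n\to\infty.$$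 In each part the supremum is over all choices of parameters $\boldsymbol p_j^{(i)}\in\mathcal C$, $i=1,\dots,I$, $j=1,\dots,n_i$.
   Context: $\mathcal C=\{\boldsymbol q=(q_1,\dots,q_K):0\le q_k\le1,\ \sum_{k=1}^K q_k=1\}$. Let $I\ge1$ and $n_1,\dots,n_I\ge1$ be integers with $\sum_{i=1}^I n_i=n$ (in part (iii), the grouping $I,n_1,\dots,n_I$ may be any grouping for each $n$). For parameters $\boldsymbol p_j^{(i)}=(p_{j1}^{(i)},\dots,p_{jK}^{(i)})\in\mathcal C$, the random vectors $\boldsymbol z_j^{(i)}=(z_{j1}^{(i)},\dots,z_{jK}^{(i)})$, $i=1,\dots,I$, $j=1,\dots,n_i$, are independent, each has exactly one entry equal to 1 and the others 0, and $\mathbb P(z_{jk}^{(i)}=1)=p_{jk}^{(i)}$. The parameters may differ across all $i,j$. The group averages are $\bar p_k^{(i)}=\frac1{n_i}\sum_{j=1}^{n_i}p_{jk}^{(i)}$. $\log$ is the natural logarithm, with $0\log0=0$ (terms with $\bar p_k^{(i)}=0$ have $p_{jk}^{(i)}=0$ and $z_{jk}^{(i)}=0$ almost surely and count as 0). $a_n=\Omega(1)$ means there is a constant $c>0$ with $a_n\ge c$ for all sufficiently large $n$. *)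

theory Defs
  imports "HOL-Probability.Probability" "HOL-Library.Landau_Symbols"
begin

definition simplex_C :: "nat \<Rightarrow> (nat \<Rightarrow> real) set" where
  "simplex_C K = {q. (\<forall>k\<in>{1..K}. 0 \<le> q k \<and> q k \<le> 1) \<and> (\<Sum>k=1..K. q k) = 1}"

definition grouping :: "nat \<Rightarrow> nat \<Rightarrow> (nat \<Rightarrow> nat) \<Rightarrow> bool" where
  "grouping n I ns \<longleftrightarrow> 1 \<le> I \<and> (\<forall>i\<in>{1..I}. 1 \<le> ns i) \<and> (\<Sum>i=1..I. ns i) = n"

(* Families are indexed in the order p i j k: group i, member j of the group, category k.
   Values outside the index ranges are unconstrained and never used. *)
definition params :: "nat \<Rightarrow> nat \<Rightarrow> (nat \<Rightarrow> nat) \<Rightarrow> (nat \<Rightarrow> nat \<Rightarrow> nat \<Rightarrow> real) set" where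
  "params K I ns = {p. \<forall>i\<in>{1..I}. \<forall>j\<in>{1..ns i}. p i j \<in> simplex_C K}"

locale categorical_sample = prob_space M for M :: "'w measure" +
  fixes K I :: nat and ns :: "nat \<Rightarrow> nat"
    and p :: "nat \<Rightarrow> nat \<Rightarrow> nat \<Rightarrow> real"
    and z :: "nat \<Rightarrow> nat \<Rightarrow> nat \<Rightarrow> 'w \<Rightarrow> real"
  assumes indep:
      "indep_vars (\<lambda>_. Pi\<^sub>M {1..K} (\<lambda>_. borel))
         (\<lambda>(i, j) \<omega>. \<lambda>k\<in>{1..K}. z i j k \<omega>) (SIGMA i:{1..I}. {1..ns i})"
    and one_hot:
      "\<And>i j \<omega>. i \<in> {1..I} \<Longrightarrow> j \<in> {1..ns i} \<Longrightarrow> \<omega> \<in> space M \<Longrightarrow>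
         \<exists>k\<in>{1..K}. z i j k \<omega> = 1 \<and> (\<forall>l\<in>{1..K} - {k}. z i j l \<omega> = 0)"
    and prob_one:
      "\<And>i j k. i \<in> {1..I} \<Longrightarrow> j \<in> {1..ns i} \<Longrightarrow> k \<in> {1..K} \<Longrightarrow>
         prob {\<omega> \<in> space M. z i j k \<omega> = 1} = p i j k"

definition p_bar :: "(nat \<Rightarrow> nat) \<Rightarrow> (nat \<Rightarrow> nat \<Rightarrow> nat \<Rightarrow> real) \<Rightarrow> nat \<Rightarrow> nat \<Rightarrow> real" where
  "p_bar ns p i k = (1 / real (ns i)) * (\<Sum>j=1..ns i. p i j k)"

(* Since ln 0 = 0 in HOL, the terms with p_bar = 0 count as 0. *)
definition deviation ::
  "nat \<Rightarrow> nat \<Rightarrow> nat \<Rightarrow> (nat \<Rightarrow> nat) \<Rightarrow> (nat \<Rightarrow> nat \<Rightarrow> nat \<Rightarrow> real) \<Rightarrow>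
   (nat \<Rightarrow> nat \<Rightarrow> nat \<Rightarrow> 'w \<Rightarrow> real) \<Rightarrow> 'w \<Rightarrow> real" where
  "deviation n K I ns p z \<omega> =
     (1 / real n) * (\<Sum>i=1..I. \<Sum>j=1..ns i.
        (\<Sum>k=1..K. z i j k \<omega> * ln (p_bar ns p i k)) - (\<Sum>k=1..K. p i j k * ln (p_bar ns p i k)))"

definition b_star :: "nat \<Rightarrow> real" where
  "b_star K = 1 / min (1 / ln (real K))
     ((ln (real K) + 2 / real K - 2) / ((1 - 1 / real K) * ln (real K)))"

(* Every parameter choice is realised by a sample on a probability space over the type
   nat * nat => nat, so assuming a sample for every parameter choice is satisfiable. *)
lemma categorical_sample_exists:
  assumes "p \<in> params K I ns"
  shows "\<exists>(M :: (nat \<times> nat \<Rightarrow> nat) measure) z. categorical_sample M K I ns p z"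
proof -
  define f where "f = (\<lambda>x k. if k \<in> {1..K} then (p (fst x) (snd x) k) else (0::real))"
  define S where "S = (SIGMA i:{1..I}. {1..ns i})"
  have S: "finite S" by (auto simp: S_def)
  define c where "c = (\<lambda>x. if x \<in> S then embed_pmf (f x) else return_pmf 0)"
  define P where "P = Pi_pmf S 0 c"
  define clip where "clip = (\<lambda>l::nat. if l \<in> {1..K} then l else 1)"
  define z :: "nat \<Rightarrow> nat \<Rightarrow> nat \<Rightarrow> (nat \<times> nat \<Rightarrow> nat) \<Rightarrow> real"
    where "z = (\<lambda>i j k w. of_bool (clip (w (i, j)) = k))"
  have simplex: "p (fst x) (snd x) \<in> simplex_C K" if "x \<in> S" for x
    using assms that by (auto simp: S_def params_def)
  have pmf: "pmf (c x) k = f x k" if x: "x \<in> S" for x k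
  proof -
    have nonneg: "0 \<le> f x k" for k
      using simplex[OF x] by (auto simp: f_def simplex_C_def)
    have "(\<integral>\<^sup>+ k. ennreal (f x k) \<partial>count_space UNIV) = (\<Sum>k\<in>{1..K}. ennreal (f x k))"
      by (rule nn_integral_count_space') (auto simp: f_def)
    also have "\<dots> = ennreal (\<Sum>k\<in>{1..K}. f x k)"
      by (rule sum_ennreal) (rule nonneg)
    also have "(\<Sum>k\<in>{1..K}. f x k) = 1"
      using simplex[OF x] by (simp add: f_def simplex_C_def)
    finally show ?thesis
      using x nonneg by (simp add: c_def pmf_embed_pmf)
  qed
  have Kpos: "1 \<in> {1..K}" if "x \<in> S" for x
    using simplex[OF that] by (cases K) (auto simp: simplex_C_def)
  have "categorical_sample (measure_pmf P) K I ns p z"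
  proof (intro categorical_sample.intro categorical_sample_axioms.intro prob_space_measure_pmf)
    have "prob_space.indep_vars (measure_pmf P) (\<lambda>_. count_space UNIV) (\<lambda>x f. f x) S"
      using indep_vars_Pi_pmf[OF S, of 0 c] by (simp add: P_def)
    then have "prob_space.indep_vars (measure_pmf P) (\<lambda>_. Pi\<^sub>M {1..K} (\<lambda>_. borel))
        (\<lambda>x w. (\<lambda>l. \<lambda>k\<in>{1..K}. of_bool (clip l = k) :: real) (w x)) S"
      by (rule prob_space.indep_vars_compose2[OF prob_space_measure_pmf]) (auto simp: space_PiM)
    also have "(\<lambda>x w. (\<lambda>l. \<lambda>k\<in>{1..K}. of_bool (clip l = k) :: real) (w x))
        = (\<lambda>(i, j) w. \<lambda>k\<in>{1..K}. z i j k w)"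
      by (auto simp: z_def fun_eq_iff)
    finally show "prob_space.indep_vars (measure_pmf P) (\<lambda>_. Pi\<^sub>M {1..K} (\<lambda>_. borel))
        (\<lambda>(i, j) w. \<lambda>k\<in>{1..K}. z i j k w) (SIGMA i:{1..I}. {1..ns i})"
      by (simp add: S_def)
  next
    fix i j and w :: "nat \<times> nat \<Rightarrow> nat"
    assume "i \<in> {1..I}" "j \<in> {1..ns i}"
    then have "1 \<in> {1..K}" by (intro Kpos[of "(i, j)"]) (auto simp: S_def)
    then show "\<exists>k\<in>{1..K}. z i j k w = 1 \<and> (\<forall>l\<in>{1..K} - {k}. z i j l w = 0)"
      by (intro bexI[of _ "clip (w (i, j))"]) (auto simp: z_def clip_def)
  next
    fix i j k
    assume ij: "i \<in> {1..I}" "j \<in> {1..ns i}" and k: "k \<in> {1..K}"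
    then have x: "(i, j) \<in> S" by (auto simp: S_def)
    have marg: "map_pmf (\<lambda>w. w (i, j)) P = c (i, j)"
      unfolding P_def using x S by (subst Pi_pmf_component) auto
    have "measure (measure_pmf P) {w \<in> space (measure_pmf P). z i j k w = 1}
        = measure (measure_pmf (map_pmf (\<lambda>w. w (i, j)) P)) {l. clip l = k}"
      by (simp add: z_def vimage_def)
    also have "\<dots> = measure (measure_pmf (c (i, j))) {l. clip l = k}"
      by (simp add: marg)
    also have "\<dots> = measure (measure_pmf (c (i, j))) {k}"
    proof (rule measure_pmf.finite_measure_eq_AE)
      show "AE l in measure_pmf (c (i, j)). (l \<in> {l. clip l = k}) = (l \<in> {k})"
      proof (rule AE_pmfI)
        fix l assume "l \<in> set_pmf (c (i, j))"
        then have "f (i, j) l \<noteq> 0" using pmf[OF x] by (simp add: set_pmf_iff)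
        then have "l \<in> {1..K}" by (auto simp: f_def split: if_splits)
        then show "(l \<in> {l. clip l = k}) = (l \<in> {k})" by (simp add: clip_def)
      qed
    qed auto
    also have "\<dots> = p i j k"
      using k by (simp add: measure_pmf_single pmf[OF x] f_def)
    finally show "measure (measure_pmf P) {w \<in> space (measure_pmf P). z i j k w = 1} = p i j k" .
  qed
  then show ?thesis by blast
qed

end

theory Submission
  imports Defs "HOL-Real_Asymp.Real_Asymp"
begin

text \<open>
  Parts (i) and (ii) are Chernoff bounds.  Write \<open>\<phi> x = exp x - 1 - x\<close> and let \<open>q\<close> range over the
  group averages.  Since \<open>E (exp X) \<le> exp (E (exp X) - 1)\<close>, the logarithm of the moment generating
  function of a group is at most the group size times \<open>\<Sum>k. q k * \<phi> (t * ln (q k))\<close>, no matter how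
  the individual parameters are distributed within the group.  For \<open>- 1 / b_star K \<le> t < 0\<close> the
  sum is largest for uniform \<open>q\<close>, hence at most \<open>(t * ln K)\<^sup>2\<close>: each summand is \<open>q k\<close> times a
  function of \<open>1 / q k\<close> that lies below its tangent at \<open>K\<close>, by the choice of \<open>b_star\<close>.  As \<open>x\<^sup>2 / 2 \<le> \<phi> x\<close> for
  \<open>x \<ge> 0\<close>, it follows that \<open>\<Sum>k. q k * (ln (q k))\<^sup>2 \<le> 2 * (ln K)\<^sup>2\<close>, which gives the same
  bound on the sum for every \<open>t > 0\<close>.  In part (iii), giving one category probability \<open>1 / 2\<close>
  and the others equal shares of the rest turns the deviation into a scaled sum of fair signs,
  to which the central limit theorem applies.
\<close>

section \<open>An exponential moment inequality on the simplex\<close>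

text \<open>Amounts to \<open>exp 8 < 5 ^ 5\<close>, which holds because
  \<open>2.72 ^ 8 < 3125\<close>.\<close>

lemma ln_5_gt: "ln (5::real) > 8 / 5"
proof -
  have "exp (8::real) = exp 1 ^ 8"
    by (simp flip: exp_of_nat_mult)
  also have "\<dots> < (272/100) ^ 8"
    by (rule power_strict_mono[OF e_less_272]) auto
  also have "\<dots> < (5::real) ^ 5"
    by (simp add: power_numeral_reduce)
  finally have "8 < ln ((5::real) ^ 5)"
    by (metis exp_gt_zero ln_exp ln_less_cancel_iff zero_less_numeral zero_less_power)
  also have "ln ((5::real) ^ 5) = 5 * ln 5"
    by (subst ln_realpow) simp_all
  finally show ?thesis
    by simp
qed

text \<open>Makes the second quotient in \<open>b_star\<close> positive. The left side is at least
  \<open>ln 5 + 1 - 3 / K\<close>, hence at least \<open>ln 5 + 2 / 5\<close>, so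
  \<open>8 / 5\<close> is exactly the bound on \<open>ln 5\<close> that is called for. The
  inequality fails at \<open>K = 4\<close>.\<close>

lemma ln_plus_two_div_gt_2:
  fixes K :: real
  assumes "K \<ge> 5"
  shows "ln K + 2 / K > 2"
proof -
  have "ln (5 / K) \<le> 5 / K - 1"
    using assms by (intro ln_le_minus_one) auto
  then have "ln K \<ge> ln 5 + 1 - 5 / K"
    using assms by (simp add: ln_div)
  moreover have "3 / K \<le> 3 / 5"
    using assms by (simp add: field_simps)
  ultimately show ?thesis
    using ln_5_gt by (simp add: field_simps)
qed

lemma ln_gt_8_5: "K \<ge> 5 \<Longrightarrow> ln (K::real) > 8 / 5"
  using ln_5_gt by (smt (verit) ln_le_cancel_iff)

section \<open>Quadratic bounds for the exponential remainder, and its tangent\<close>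

definition exp_rem :: "real \<Rightarrow> real" where
  "exp_rem x = exp x - 1 - x"

text \<open>The Lagrange remainder \<open>exp t / 6 * x ^ 3\<close> after the quadratic Taylor term
  is nonpositive here.\<close>

lemma exp_rem_le_half_square:
  assumes "x \<le> 0" shows "exp_rem x \<le> x\<^sup>2 / 2"
proof -
  obtain t where t: "\<bar>t\<bar> \<le> \<bar>x\<bar>" "exp x = (\<Sum>m<3. x ^ m / fact m) + exp t / fact 3 * x ^ 3"
    using Maclaurin_exp_le[of x 3] by blast
  have "exp t / fact 3 * x ^ 3 \<le> 0"
    using assms by (intro mult_nonneg_nonpos) auto
  moreover have "(\<Sum>m<3. x ^ m / fact m) = 1 + x + x\<^sup>2 / 2"
    by (simp add: numeral_3_eq_3 power2_eq_square)
  ultimately show ?thesis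
    using t(2) unfolding exp_rem_def by linarith
qed

lemma half_square_le_exp_rem:
  assumes "0 \<le> x" shows "x\<^sup>2 / 2 \<le> exp_rem x"
  using exp_lower_Taylor_quadratic[OF assms] by (simp add: exp_rem_def)

text \<open>
  With \<open>u = 1 / q\<close>, this is the tangent to \<open>u \<mapsto> exp_rem (t * ln u)\<close> at \<open>u = K\<close>.  The function is
  convex up to an inflection point \<open>u0 \<le> K\<close> and concave afterwards, so it is enough
  that the tangent lies above it at \<open>u = 1\<close>; this is what the bound on \<open>t\<close> provides.
\<close>
lemma exp_rem_ln_le_tangent:
  fixes K t u :: real
  assumes K: "K \<ge> 5" and t: "0 < t" and t1: "t * ln K \<le> 1"
    and t2: "t * ((1 - 1 / K) * ln K) \<le> ln K + 2 / K - 2" and u: "1 \<le> u"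
  shows "exp_rem (t * ln u) \<le> exp_rem (t * ln K) + t * (exp (t * ln K) - 1) / K * (u - K)"
proof -
  define L s where "L = ln K" and "s = t * L"
  define h where "h = (\<lambda>u. exp_rem (t * ln u))"
  define h' where "h' = (\<lambda>u. t * (exp (t * ln u) - 1) / u)"
  define h'' where "h'' = (\<lambda>u. t * (1 - (1 - t) * exp (t * ln u)) / u\<^sup>2)"
  define D where "D = (\<lambda>u. h K + h' K * (u - K) - h u)"
  have L: "L > 8 / 5" using ln_gt_8_5[OF K] by (simp add: L_def)
  have s: "0 < s" "s \<le> 1" using t t1 L by (auto simp: s_def L_def)
  have ts: "t < 1"
  proof (rule ccontr)
    assume "\<not> t < 1"
    then have "1 * L \<le> s" unfolding s_def using L by (intro mult_right_mono) auto
    then show False using s L by simp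
  qed
  have D1: "(h has_real_derivative h' x) (at x)" if "x > 0" for x
    unfolding h_def h'_def exp_rem_def using that
    by (auto intro!: derivative_eq_intros simp: field_simps)
  have D2: "(h' has_real_derivative h'' x) (at x)" if "x > 0" for x
    unfolding h'_def h''_def using that
    by (auto intro!: derivative_eq_intros simp: field_simps power2_eq_square)
  define c where "c = 1 - 1 / K"
  have c: "4 / 5 \<le> c" "c < 1" using K by (auto simp: c_def field_simps)
  have t2': "t * c * L \<le> L - 2 * c"
    using t2 by (simp add: c_def L_def algebra_simps)
  \<comment> \<open>Hypothesis \<open>t2\<close> times \<open>t\<close>; in this form it serves both
    at \<open>u = 1\<close> and for \<open>u0 < K\<close>.\<close>
  have key: "t * c * (2 + s) \<le> s"
  proof -
    have "t * (t * c * L) \<le> t * (L - 2 * c)"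
      using t2' t by (intro mult_left_mono) auto
    then show ?thesis by (simp add: s_def algebra_simps)
  qed
  \<comment> \<open>\<open>D 1\<close> equals \<open>(exp s - 1 - s) - t * c * (exp s - 1)\<close>.
    As \<open>t * c \<le> s / (2 + s)\<close> by \<open>key\<close>, it is enough that
    \<open>exp s - 1 \<ge> s + s\<^sup>2 / 2\<close>.\<close>
  have D_at_1: "D 1 \<ge> 0"
  proof -
    have "s\<^sup>2 / 2 \<le> exp_rem s" using s by (intro half_square_le_exp_rem) auto
    then have e: "exp s - 1 \<ge> s + s\<^sup>2 / 2" by (simp add: exp_rem_def)
    have "(2 + s) * (t * c * (exp s - 1)) = (t * c * (2 + s)) * (exp s - 1)" by simp
    also have "\<dots> \<le> s * (exp s - 1)"
      using key s by (intro mult_right_mono) auto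
    also have "\<dots> = (2 + s) * (exp s - 1) - 2 * (exp s - 1)" by (simp add: algebra_simps)
    also have "\<dots> \<le> (2 + s) * (exp s - 1) - s * (2 + s)"
      using e by (simp add: power2_eq_square algebra_simps)
    also have "\<dots> = (2 + s) * (exp s - 1 - s)" by (simp add: algebra_simps)
    finally have "t * c * (exp s - 1) \<le> exp s - 1 - s"
      using s by simp
    moreover have "D 1 = (exp s - 1 - s) - t * c * (exp s - 1)"
      using K by (simp add: D_def h_def h'_def exp_rem_def s_def L_def c_def field_simps)
    ultimately show ?thesis by simp
  qed
  \<comment> \<open>The zero of \<open>h''\<close>, where \<open>u\<close> to the power
    \<open>t\<close> equals \<open>1 / (1 - t)\<close>.\<close>
  define u0 where "u0 = exp (- ln (1 - t) / t)"
  have u0_1: "1 \<le> u0"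
    using t ts by (simp add: u0_def divide_nonpos_pos)
  have exp_u0: "exp (t * ln u0) = 1 / (1 - t)"
  proof -
    have "t * ln u0 = - ln (1 - t)" using t by (simp add: u0_def del: exp_minus)
    then show ?thesis using ts by (simp add: exp_minus inverse_eq_divide)
  qed
  have mono: "exp (t * ln x) \<le> exp (t * ln y)" if "0 < x" "x \<le> y" for x y
    using that t by simp
  \<comment> \<open>Amounts to \<open>(1 - t) * exp s > 1\<close>, which follows from
    \<open>t * (1 + s) < s\<close>. By \<open>key\<close> and \<open>c \<ge> 4 / 5\<close>,
    \<open>t * (2 + s) \<le> 5 / 4 * s\<close>, and \<open>5 / 4 * (1 + s) < 2 + s\<close> because
    \<open>s \<le> 1\<close>.\<close>
  have u0_K: "u0 < K"
  proof -
    have "4 / 5 * (t * (2 + s)) \<le> c * (t * (2 + s))"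
      using c t s by (intro mult_right_mono) auto
    also have "\<dots> = t * c * (2 + s)" by simp
    finally have *: "t * (2 + s) \<le> 5 / 4 * s" using key by linarith
    have "t * (1 + s) < s"
    proof -
      have "(2 + s) * (t * (1 + s)) = (t * (2 + s)) * (1 + s)" by simp
      also have "\<dots> \<le> 5 / 4 * s * (1 + s)" using * s by (intro mult_right_mono) auto
      also have "\<dots> = s * (5 / 4 + 5 / 4 * s)" by (simp add: algebra_simps)
      also have "\<dots> < s * (2 + s)" using s by (intro mult_strict_left_mono) auto
      finally show ?thesis using s by (simp add: mult.commute)
    qed
    then have "1 < (1 - t) * (1 + s)" by (simp add: algebra_simps)
    also have "\<dots> \<le> (1 - t) * exp s"
      using ts s by (intro mult_left_mono exp_ge_add_one_self) auto
    finally have "1 / (1 - t) < exp s" using ts by (simp add: field_simps)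
    then have "exp (t * ln u0) < exp (t * ln K)" by (simp add: exp_u0 s_def L_def)
    then show ?thesis using mono[of K u0] K by linarith
  qed
  have DD: "(D has_real_derivative (h' K - h' x)) (at x)" if "x > 0" for x
    unfolding D_def using D1[OF that] by (auto intro!: derivative_eq_intros)
  have DD2: "((\<lambda>x. h' K - h' x) has_real_derivative (- h'' x)) (at x)" if "x > 0" for x
    using D2[OF that] by (auto intro!: derivative_eq_intros)
  \<comment> \<open>The names \<open>concave\<close> and \<open>convex\<close> refer to
    \<open>h\<close>; \<open>D\<close> bends the opposite way. Here \<open>D\<close> is convex with
    value and slope 0 at \<open>K\<close>, hence nonnegative.\<close>
  have concave: "D x \<ge> 0" if x: "u0 \<le> x" for x
  proof -
    have "convex_on {u0..} D"
    proof (rule f''_ge0_imp_convex)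
      fix x assume x: "x \<in> {u0..}"
      then have x0: "x > 0" using u0_1 by auto
      show "(D has_real_derivative (h' K - h' x)) (at x)" by (rule DD[OF x0])
      show "((\<lambda>x. h' K - h' x) has_real_derivative (- h'' x)) (at x)" by (rule DD2[OF x0])
      have "1 / (1 - t) \<le> exp (t * ln x)" using mono[of u0 x] exp_u0 x u0_1 by auto
      then have "1 \<le> (1 - t) * exp (t * ln x)" using ts by (simp add: field_simps)
      then show "0 \<le> - h'' x"
        using t x0 by (simp add: h''_def divide_nonpos_pos mult_nonneg_nonpos)
    qed auto
    then have "0 * (x - K) \<le> D x - D K"
    proof (rule convex_on_imp_above_tangent)
      show "(D has_real_derivative 0) (at K within {u0..})"
        using DD[of K] K by (auto intro: DERIV_subset)
    qed (use x u0_K in auto)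
    then show ?thesis by (simp add: D_def)
  qed
  \<comment> \<open>Here \<open>- D\<close> is convex, so it lies below the larger of its values at
    \<open>1\<close> and \<open>u0\<close>, neither of which is positive.\<close>
  have convex: "D x \<ge> 0" if x: "1 \<le> x" "x \<le> u0" for x
  proof -
    have "convex_on {1..u0} (\<lambda>x. - D x)"
    proof (rule f''_ge0_imp_convex)
      fix x assume x: "x \<in> {1..u0}"
      then have x0: "x > 0" by auto
      show "((\<lambda>x. - D x) has_real_derivative (h' x - h' K)) (at x)"
        using DD[OF x0] by (auto intro!: derivative_eq_intros)
      show "((\<lambda>x. h' x - h' K) has_real_derivative h'' x) (at x)"
        using D2[OF x0] by (auto intro!: derivative_eq_intros)
      have "exp (t * ln x) \<le> 1 / (1 - t)" using mono[of x u0] exp_u0 x x0 by auto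
      then have "(1 - t) * exp (t * ln x) \<le> 1" using ts by (simp add: field_simps)
      then show "0 \<le> h'' x"
        using t x0 by (simp add: h''_def)
    qed auto
    from convex_on_le_max[OF this, of x] x have "- D x \<le> max (- D 1) (- D u0)" by auto
    then show ?thesis using D_at_1 concave[of u0] by auto
  qed
  have "D u \<ge> 0" using concave[of u] convex[of u] u by linarith
  then show ?thesis by (simp add: D_def h_def h'_def)
qed

lemma ln_simplex_nonpos:
  assumes "q \<in> simplex_C K" "k \<in> {1..K}"
  shows "ln (q k) \<le> 0"
  using assms by (cases "q k = 0") (auto simp: simplex_C_def order.strict_iff_order)

text \<open>The tangent evaluated at \<open>1 / q k\<close> and multiplied by \<open>q k\<close> is
  affine in \<open>q k\<close>, so its sum is the same at every point of the simplex, namely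
  \<open>A\<close>. Finally \<open>exp x \<le> 1 + x + x\<^sup>2\<close> on the unit interval bounds
  \<open>A\<close>.\<close>

lemma sum_simplex_exp_rem_le:
  assumes K: "K \<ge> 5" and t: "0 < t" "t * ln (real K) \<le> 1"
    "t * ((1 - 1 / K) * ln (real K)) \<le> ln (real K) + 2 / real K - 2"
    and q: "q \<in> simplex_C K"
  shows "(\<Sum>k=1..K. q k * exp_rem (- t * ln (q k))) \<le> (t * ln (real K))\<^sup>2"
proof -
  define A where "A = exp_rem (t * ln (real K))"
  define B where "B = t * (exp (t * ln (real K)) - 1) / real K"
  have B: "B \<ge> 0" using K t by (simp add: B_def)
  have "q k * exp_rem (- t * ln (q k)) \<le> q k * A + B * (1 - K * q k)" if k: "k \<in> {1..K}" for k
  proof (cases "q k = 0")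
    case False
    then have qk: "0 < q k" "q k \<le> 1" using q k by (auto simp: simplex_C_def order.strict_iff_order)
    then have "exp_rem (- t * ln (q k)) = exp_rem (t * ln (1 / q k))"
      by (simp add: ln_div)
    also have "\<dots> \<le> A + B * (1 / q k - K)"
      unfolding A_def B_def using K t qk by (intro exp_rem_ln_le_tangent) auto
    finally have "q k * exp_rem (- t * ln (q k)) \<le> q k * (A + B * (1 / q k - K))"
      using qk by (intro mult_left_mono) auto
    also have "\<dots> = q k * A + B * (1 - K * q k)"
      using qk by (simp add: field_simps)
    finally show ?thesis .
  \<comment> \<open>For \<open>q k = 0\<close> the left side vanishes and the right side is
    \<open>B\<close>.\<close>
  qed (use B in auto)
  then have "(\<Sum>k=1..K. q k * exp_rem (- t * ln (q k))) \<le> (\<Sum>k=1..K. q k * A + B * (1 - K * q k))"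
    by (rule sum_mono)
  also have "\<dots> = (\<Sum>k=1..K. q k) * A + B * (K - K * (\<Sum>k=1..K. q k))"
    by (simp add: sum.distrib sum_distrib_right sum_distrib_left right_diff_distrib sum_subtractf)
  also have "\<dots> = A" using q by (simp add: simplex_C_def)
  also have "A \<le> (t * ln (real K))\<^sup>2"
    using exp_bound[of "t * ln (real K)"] t K by (simp add: A_def exp_rem_def)
  finally show ?thesis .
qed

text \<open>The minimum in \<open>b_star\<close> is over the two upper bounds on \<open>t\<close>
  required by the tangent lemma, so \<open>1 / b_star K\<close> is the largest admissible
  \<open>t\<close>.\<close>

lemma
  assumes "K \<ge> 5"
  shows b_star_pos: "0 < b_star K"
    and inverse_b_star_mult_ln_le: "1 / b_star K * ln (real K) \<le> 1"
    and inverse_b_star_mult_le: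
      "1 / b_star K * ((1 - 1 / K) * ln (real K)) \<le> ln (real K) + 2 / real K - 2"
proof -
  define L where "L = ln (real K)"
  have L: "L > 0" using assms by (simp add: L_def)
  have num: "L + 2 / real K - 2 > 0"
    using ln_plus_two_div_gt_2[of "real K"] assms by (simp add: L_def)
  have den: "(1 - 1 / K) * L > 0" using L assms by simp
  have eq: "1 / b_star K = min (1 / L) ((L + 2 / real K - 2) / ((1 - 1 / K) * L))"
    by (simp add: b_star_def L_def)
  have "1 / b_star K > 0" unfolding eq using L num den by (simp add: divide_pos_pos)
  then show "0 < b_star K" by simp
  have "1 / b_star K \<le> 1 / L" unfolding eq by simp
  then show "1 / b_star K * ln (real K) \<le> 1" using L by (simp add: L_def[symmetric] field_simps)
  have "1 / b_star K \<le> (L + 2 / real K - 2) / ((1 - 1 / K) * L)" unfolding eq by simp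
  then show "1 / b_star K * ((1 - 1 / K) * ln (real K)) \<le> ln (real K) + 2 / real K - 2"
    using den unfolding L_def[symmetric] by (simp only: pos_le_divide_eq)
qed

lemma sum_simplex_exp_rem_le_b_star:
  assumes K: "K \<ge> 5" and t: "0 < t" "t \<le> 1 / b_star K" and q: "q \<in> simplex_C K"
  shows "(\<Sum>k=1..K. q k * exp_rem (- t * ln (q k))) \<le> (t * ln (real K))\<^sup>2"
proof (rule sum_simplex_exp_rem_le[OF K t(1) _ _ q])
  have "t * ln (real K) \<le> 1 / b_star K * ln (real K)"
    using t K by (intro mult_right_mono) auto
  with inverse_b_star_mult_ln_le[OF K] show "t * ln (real K) \<le> 1" by linarith
  have "t * ((1 - 1 / K) * ln (real K)) \<le> 1 / b_star K * ((1 - 1 / K) * ln (real K))"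
    using t K by (intro mult_right_mono) auto
  with inverse_b_star_mult_le[OF K]
  show "t * ((1 - 1 / K) * ln (real K)) \<le> ln (real K) + 2 / real K - 2" by linarith
qed

lemma sum_simplex_ln_square_le:
  assumes K: "K \<ge> 5" and q: "q \<in> simplex_C K"
  shows "(\<Sum>k=1..K. q k * (ln (q k))\<^sup>2) \<le> 2 * (ln (real K))\<^sup>2"
proof -
  \<comment> \<open>Any admissible \<open>t\<close> would do, as \<open>t\<^sup>2\<close> cancels at
    the end.\<close>
  define t where "t = 1 / b_star K"
  have t: "t > 0" using b_star_pos[OF K] by (simp add: t_def)
  have "(\<Sum>k=1..K. q k * ((- t * ln (q k))\<^sup>2 / 2)) \<le> (\<Sum>k=1..K. q k * exp_rem (- t * ln (q k)))"
  proof (intro sum_mono mult_left_mono half_square_le_exp_rem)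
    fix k assume k: "k \<in> {1..K}"
    show "0 \<le> q k" using q k by (auto simp: simplex_C_def)
    show "0 \<le> - t * ln (q k)" using t ln_simplex_nonpos[OF q k] by (simp add: mult_nonneg_nonpos)
  qed
  also have "\<dots> \<le> (t * ln (real K))\<^sup>2"
    using sum_simplex_exp_rem_le_b_star[OF K t _ q] by (simp add: t_def)
  finally have "t\<^sup>2 / 2 * (\<Sum>k=1..K. q k * (ln (q k))\<^sup>2) \<le> t\<^sup>2 / 2 * (2 * (ln (real K))\<^sup>2)"
    by (simp add: sum_distrib_left power_mult_distrib mult_ac)
  then show ?thesis using t by (subst (asm) mult_le_cancel_left_pos) auto
qed

section \<open>Chernoff bounds for the deviation\<close>

lemma sum_p_members:
  assumes "grouping n I ns" "i \<in> {1..I}"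
  shows "(\<Sum>j=1..ns i. p i j k) = real (ns i) * p_bar ns p i k"
  using assms by (auto simp: p_bar_def grouping_def)

lemma p_bar_simplex:
  assumes "grouping n I ns" "p \<in> params K I ns" "i \<in> {1..I}"
  shows "p_bar ns p i \<in> simplex_C K"
proof -
  have ns: "real (ns i) > 0" using assms by (force simp: grouping_def)
  have pj: "p i j \<in> simplex_C K" if "j \<in> {1..ns i}" for j
    using assms that by (auto simp: params_def)
  have nonneg: "0 \<le> p_bar ns p i k" if "k \<in> {1..K}" for k
    using pj that unfolding p_bar_def simplex_C_def by (intro mult_nonneg_nonneg sum_nonneg) auto
  have "(\<Sum>k=1..K. p_bar ns p i k) = 1 / real (ns i) * (\<Sum>j=1..ns i. \<Sum>k=1..K. p i j k)"
    unfolding p_bar_def sum_distrib_left[symmetric] by (subst sum.swap) simp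
  also have "(\<Sum>j=1..ns i. \<Sum>k=1..K. p i j k) = real (ns i)"
    using pj by (simp add: simplex_C_def)
  finally have total: "(\<Sum>k=1..K. p_bar ns p i k) = 1"
    using ns by simp
  have "p_bar ns p i k \<le> 1" if "k \<in> {1..K}" for k
    using member_le_sum[of k "{1..K}" "p_bar ns p i"] nonneg that total by auto
  with nonneg total show ?thesis by (simp add: simplex_C_def)
qed

lemma grouping_pos:
  assumes "grouping n I ns"
  shows "0 < n"
proof -
  have "0 < ns 1" "ns 1 \<le> (\<Sum>i=1..I. ns i)"
    using assms by (auto simp: grouping_def Suc_le_eq intro!: member_le_sum)
  then show ?thesis using assms by (simp add: grouping_def)
qed

text \<open>A common upper bound controls a supremum of reals only over a nonempty set.\<close>

lemma params_nonempty:
  assumes "K \<ge> 1"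
  shows "params K I ns \<noteq> {}"
proof -
  have "(\<lambda>_ _ k. of_bool (k = 1)) \<in> params K I ns"
    using assms by (simp add: params_def simplex_C_def of_bool_def)
  then show ?thesis by blast
qed

section \<open>Scores of the members and their exponential moments\<close>

context categorical_sample
begin

abbreviation "members \<equiv> SIGMA i:{1..I}. {1..ns i}"

text \<open>The weights \<open>a\<close> stay free: the Chernoff bounds take multiples of
  log-probabilities, the central limit argument takes scaled signs.\<close>

definition score :: "(nat \<Rightarrow> nat \<Rightarrow> real) \<Rightarrow> nat \<times> nat \<Rightarrow> 'w \<Rightarrow> real" where
  "score a x \<omega> = (\<Sum>k=1..K. z (fst x) (snd x) k \<omega> * a (fst x) k)"

lemma z_measurable [measurable]:
  assumes "i \<in> {1..I}" "j \<in> {1..ns i}" "k \<in> {1..K}"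
  shows "z i j k \<in> borel_measurable M"
proof -
  have "(\<lambda>\<omega>. \<lambda>k\<in>{1..K}. z i j k \<omega>) \<in> M \<rightarrow>\<^sub>M Pi\<^sub>M {1..K} (\<lambda>_. borel)"
    using indep assms unfolding indep_vars_def by fastforce
  from measurable_compose[OF this measurable_component_singleton[OF assms(3)]] show ?thesis
    using assms by simp
qed

lemma indep_score: "indep_vars (\<lambda>_. borel) (score a) members"
proof -
  have "indep_vars (\<lambda>_. borel)
      (\<lambda>x \<omega>. (\<lambda>f. \<Sum>k=1..K. f k * a (fst x) k)
        ((\<lambda>(i, j) \<omega>. \<lambda>k\<in>{1..K}. z i j k \<omega>) x \<omega>)) members"
    by (rule indep_vars_compose2[OF indep]) measurable
  also have "(\<lambda>x \<omega>. (\<lambda>f. \<Sum>k=1..K. f k * a (fst x) k)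
        ((\<lambda>(i, j) \<omega>. \<lambda>k\<in>{1..K}. z i j k \<omega>) x \<omega>)) = score a"
    by (auto simp: score_def fun_eq_iff intro!: sum.cong)
  finally show ?thesis .
qed

text \<open>By \<open>one_hot\<close>, any \<open>g\<close> of the score is a finite sum of
  indicators times constants. The general codomain admits the complex exponentials of characteristic
  functions.\<close>

lemma
  fixes g :: "real \<Rightarrow> 'b :: {banach, second_countable_topology}"
  assumes x: "x \<in> members"
  shows integrable_score: "integrable M (\<lambda>\<omega>. g (score a x \<omega>))" (is ?int)
    and expectation_score:
      "(LINT \<omega>|M. g (score a x \<omega>)) = (\<Sum>k=1..K. p (fst x) (snd x) k *\<^sub>R g (a (fst x) k))" (is ?eq)
proof -
  obtain i j where ij: "x = (i, j)" "i \<in> {1..I}" "j \<in> {1..ns i}" using x by auto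
  define A where "A = (\<lambda>k. {\<omega> \<in> space M. z i j k \<omega> = 1})"
  have A: "A k \<in> sets M" if "k \<in> {1..K}" for k
  proof -
    note [measurable] = z_measurable[OF ij(2,3) that]
    show ?thesis unfolding A_def by measurable
  qed
  have eq: "g (score a x \<omega>) = (\<Sum>k=1..K. indicator (A k) \<omega> *\<^sub>R g (a i k))" if "\<omega> \<in> space M" for \<omega>
  proof -
    obtain k where k: "k \<in> {1..K}" "z i j k \<omega> = 1" "\<And>l. l \<in> {1..K} - {k} \<Longrightarrow> z i j l \<omega> = 0"
      using one_hot[OF ij(2,3) \<open>\<omega> \<in> space M\<close>] by blast
    have "score a x \<omega> = (\<Sum>l=1..K. if l = k then a i l else 0)"
      unfolding score_def ij using k by (intro sum.cong) auto
    moreover have "(\<Sum>l=1..K. indicator (A l) \<omega> *\<^sub>R g (a i l)) = (\<Sum>l=1..K. if l = k then g (a i l) else 0)"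
      using k that by (intro sum.cong) (auto simp: A_def indicator_def)
    ultimately show ?thesis using k(1) by simp
  qed
  have int: "integrable M (\<lambda>\<omega>. indicator (A k) \<omega> *\<^sub>R g (a i k))" if "k \<in> {1..K}" for k
    using A[OF that] by (intro integrable_scaleR_left) (auto simp: emeasure_eq_measure)
  show ?int
    by (subst Bochner_Integration.integrable_cong[OF refl eq])
      (assumption, rule Bochner_Integration.integrable_sum[OF int])
  have "(LINT \<omega>|M. g (score a x \<omega>)) = (LINT \<omega>|M. (\<Sum>k=1..K. indicator (A k) \<omega> *\<^sub>R g (a i k)))"
    by (rule Bochner_Integration.integral_cong[OF refl eq])
  also have "\<dots> = (\<Sum>k=1..K. LINT \<omega>|M. indicator (A k) \<omega> *\<^sub>R g (a i k))"
    by (rule Bochner_Integration.integral_sum) (rule int)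
  also have "\<dots> = (\<Sum>k=1..K. p i j k *\<^sub>R g (a i k))"
  proof (rule sum.cong[OF refl])
    fix k assume k: "k \<in> {1..K}"
    have "(LINT \<omega>|M. indicator (A k) \<omega> *\<^sub>R g (a i k)) = (LINT \<omega>|M. indicator (A k) \<omega>) *\<^sub>R g (a i k)"
      using A[OF k] by (intro integral_scaleR_left) (auto simp: emeasure_eq_measure)
    also have "(LINT \<omega>|M. indicator (A k) \<omega>) = prob (A k)"
      using A[OF k] sets.sets_into_space by (simp add: Int_absorb2)
    also have "\<dots> = p i j k" unfolding A_def by (rule prob_one[OF ij(2,3) k])
    finally show "(LINT \<omega>|M. indicator (A k) \<omega> *\<^sub>R g (a i k)) = p i j k *\<^sub>R g (a i k)" .
  qed
  finally show ?eq by (simp add: ij)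
qed

text \<open>The bound \<open>E (exp X) \<le> exp (E (exp X) - 1)\<close> makes the exponent linear in \<open>p\<close>.\<close>
lemma chernoff_score:
  assumes p: "p \<in> params K I ns"
  shows "prob {\<omega> \<in> space M. c \<le> (\<Sum>x\<in>members. score a x \<omega> - (\<Sum>k=1..K. p (fst x) (snd x) k * a (fst x) k))}
    \<le> exp ((\<Sum>x\<in>members. \<Sum>k=1..K. p (fst x) (snd x) k * exp_rem (a (fst x) k)) - c)"
proof -
  define m where "m = (\<lambda>x. \<Sum>k=1..K. p (fst x) (snd x) k * a (fst x) k)"
  define r where "r = (\<lambda>x. \<Sum>k=1..K. p (fst x) (snd x) k * exp_rem (a (fst x) k))"
  define g where "g = (\<lambda>x \<omega>. exp (score a x \<omega> - m x))"
  have fin: "finite members" by simp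
  have int: "integrable M (g x)" if "x \<in> members" for x
    unfolding g_def using integrable_score[OF that, of "\<lambda>y. exp (y - m x)" a] by simp
  have indep_g: "indep_vars (\<lambda>_. borel) g members"
    unfolding g_def by (rule indep_vars_compose2[OF indep_score]) auto
  have le: "(LINT \<omega>|M. g x \<omega>) \<le> exp (r x)" if x: "x \<in> members" for x
  proof -
    have total: "(\<Sum>k=1..K. p (fst x) (snd x) k) = 1"
      using p x by (auto simp: params_def simplex_C_def)
    have "(LINT \<omega>|M. g x \<omega>) = (\<Sum>k=1..K. p (fst x) (snd x) k * exp (a (fst x) k - m x))"
      using expectation_score[OF x, of "\<lambda>y. exp (y - m x)" a] by (simp add: g_def)
    also have "\<dots> = exp (- m x) * (\<Sum>k=1..K. p (fst x) (snd x) k * exp (a (fst x) k))"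
      by (simp add: sum_distrib_left exp_diff exp_minus field_simps)
    also have "(\<Sum>k=1..K. p (fst x) (snd x) k * exp (a (fst x) k)) = 1 + (m x + r x)"
      using total unfolding m_def r_def exp_rem_def
      by (simp add: right_diff_distrib sum_subtractf)
    also have "\<dots> \<le> exp (m x + r x)" by (rule exp_ge_add_one_self)
    finally show ?thesis by (simp flip: exp_add)
  qed
  have "prob {\<omega> \<in> space M. c \<le> (\<Sum>x\<in>members. score a x \<omega> - m x)}
      = prob {\<omega> \<in> space M. exp c \<le> (\<Prod>x\<in>members. g x \<omega>)}"
    by (simp add: g_def flip: exp_sum)
  also have "\<dots> \<le> (LINT \<omega>|M. (\<Prod>x\<in>members. g x \<omega>)) / exp c"
    by (rule integral_Markov_inequality_measure[OF indep_vars_integrable[OF fin indep_g int], of "{}"])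
      (auto simp: g_def intro!: prod_nonneg)
  also have "(LINT \<omega>|M. (\<Prod>x\<in>members. g x \<omega>)) = (\<Prod>x\<in>members. LINT \<omega>|M. g x \<omega>)"
    by (rule indep_vars_lebesgue_integral[OF fin indep_g int])
  also have "\<dots> / exp c \<le> (\<Prod>x\<in>members. exp (r x)) / exp c"
    using le by (intro divide_right_mono prod_mono conjI) (auto simp: g_def intro!: Bochner_Integration.integral_nonneg)
  also have "\<dots> = exp ((\<Sum>x\<in>members. r x) - c)"
    by (simp add: exp_sum exp_diff)
  finally show ?thesis unfolding m_def r_def .
qed

text \<open>The factor \<open>n\<close> undoes the averaging and leaves the centred sum that
  \<open>chernoff_score\<close> bounds.\<close>

lemma deviation_eq_sum_score:
  assumes "0 < n"
  shows "t * deviation n K I ns p z \<omega> * n = (\<Sum>x\<in>members.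
     score (\<lambda>i k. t * ln (p_bar ns p i k)) x \<omega>
       - (\<Sum>k=1..K. p (fst x) (snd x) k * (t * ln (p_bar ns p (fst x) k))))"
  using assms unfolding deviation_def score_def
  by (subst sum.Sigma) (auto simp: sum_distrib_left right_diff_distrib case_prod_beta mult_ac intro!: sum.cong)

text \<open>The weights depend on group and category only, so the members of group \<open>i\<close>
  enter the exponent through \<open>ns i\<close> times their average. Bounding the sum at each
  average by \<open>B\<close> gives \<open>n * B\<close>. As \<open>t\<close> may have either sign,
  both tails are covered.\<close>

lemma chernoff_deviation:
  assumes grouping: "grouping n I ns" and p: "p \<in> params K I ns"
    and B: "\<And>q. q \<in> simplex_C K \<Longrightarrow> (\<Sum>k=1..K. q k * exp_rem (t * ln (q k))) \<le> B"
  shows "prob {\<omega> \<in> space M. c \<le> t * deviation n K I ns p z \<omega>} \<le> exp (real n * (B - c))"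
proof -
  have n: "0 < n" by (rule grouping_pos[OF grouping])
  define f where "f = (\<lambda>i k. exp_rem (t * ln (p_bar ns p i k)))"
  have "(\<Sum>x\<in>members. \<Sum>k=1..K. p (fst x) (snd x) k * f (fst x) k)
      = (\<Sum>i=1..I. \<Sum>j=1..ns i. \<Sum>k=1..K. p i j k * f i k)"
    by (subst sum.Sigma) (auto simp: case_prod_beta)
  also have "\<dots> = (\<Sum>i=1..I. \<Sum>k=1..K. (\<Sum>j=1..ns i. p i j k) * f i k)"
    unfolding sum_distrib_right by (rule sum.cong[OF refl], rule sum.swap)
  also have "\<dots> = (\<Sum>i=1..I. real (ns i) * (\<Sum>k=1..K. p_bar ns p i k * f i k))"
    using sum_p_members[OF grouping] by (simp add: sum_distrib_left mult.assoc)
  also have "\<dots> \<le> (\<Sum>i=1..I. real (ns i) * B)"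
    using B p_bar_simplex[OF grouping p] unfolding f_def by (intro sum_mono mult_left_mono) auto
  also have "\<dots> = n * B"
    using grouping by (simp add: grouping_def flip: sum_distrib_right of_nat_sum)
  finally have le: "(\<Sum>x\<in>members. \<Sum>k=1..K. p (fst x) (snd x) k * f (fst x) k) \<le> n * B" .
  have "{\<omega> \<in> space M. c \<le> t * deviation n K I ns p z \<omega>}
     = {\<omega> \<in> space M. c * n \<le> t * deviation n K I ns p z \<omega> * n}"
    using n by simp
  then have "prob {\<omega> \<in> space M. c \<le> t * deviation n K I ns p z \<omega>}
     \<le> exp ((\<Sum>x\<in>members. \<Sum>k=1..K. p (fst x) (snd x) k * f (fst x) k) - c * n)"
    using chernoff_score[OF p, of "c * n" "\<lambda>i k. t * ln (p_bar ns p i k)"]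
    unfolding f_def deviation_eq_sum_score[OF n] by simp
  also have "\<dots> \<le> exp (real n * (B - c))"
    using le by (simp add: algebra_simps)
  finally show ?thesis .
qed

section \<open>The two tails\<close>

lemma deviation_upper_tail:
  assumes "5 \<le> K" "0 < \<epsilon>" "grouping n I ns" "p \<in> params K I ns"
  shows "prob {\<omega> \<in> space M. deviation n K I ns p z \<omega> \<ge> \<epsilon>}
    \<le> exp (- (real n * \<epsilon>\<^sup>2 / (4 * (ln (real K))\<^sup>2)))"
proof -
  define L where "L = ln (real K)"
  have L: "L > 0" using assms by (simp add: L_def)
  \<comment> \<open>Minimises the exponent \<open>t\<^sup>2 * L\<^sup>2 - t * \<epsilon>\<close>.
    Every \<open>t > 0\<close> is allowed, because \<open>t * ln (q k) \<le> 0\<close> gives access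
    to the half-square bound.\<close>
  define t where "t = \<epsilon> / (2 * L\<^sup>2)"
  have t: "t > 0" using assms L by (simp add: t_def)
  have "(\<Sum>k=1..K. q k * exp_rem (t * ln (q k))) \<le> t\<^sup>2 * L\<^sup>2" if q: "q \<in> simplex_C K" for q
  proof -
    have "(\<Sum>k=1..K. q k * exp_rem (t * ln (q k))) \<le> (\<Sum>k=1..K. q k * ((t * ln (q k))\<^sup>2 / 2))"
    proof (intro sum_mono mult_left_mono exp_rem_le_half_square)
      fix k assume k: "k \<in> {1..K}"
      show "0 \<le> q k" using q k by (auto simp: simplex_C_def)
      show "t * ln (q k) \<le> 0" using t ln_simplex_nonpos[OF q k] by (simp add: mult_nonneg_nonpos)
    qed
    also have "\<dots> = t\<^sup>2 / 2 * (\<Sum>k=1..K. q k * (ln (q k))\<^sup>2)"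
      by (simp add: sum_distrib_left power_mult_distrib mult_ac)
    also have "\<dots> \<le> t\<^sup>2 / 2 * (2 * L\<^sup>2)"
      using sum_simplex_ln_square_le[OF assms(1) q] by (intro mult_left_mono) (auto simp: L_def)
    finally show ?thesis by simp
  qed
  from chernoff_deviation[OF assms(3,4) this, of "t * \<epsilon>"]
  have "prob {\<omega> \<in> space M. deviation n K I ns p z \<omega> \<ge> \<epsilon>} \<le> exp (real n * (t\<^sup>2 * L\<^sup>2 - t * \<epsilon>))"
    using t by simp
  also have "t\<^sup>2 * L\<^sup>2 - t * \<epsilon> = - (\<epsilon>\<^sup>2 / (4 * L\<^sup>2))"
    using L by (simp add: t_def field_simps power2_eq_square)
  finally show ?thesis by (simp add: L_def)
qed

text \<open>The Chernoff bound is used at \<open>- t\<close> with \<open>0 < t \<le> 1 / b\<close>.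
  The minimiser \<open>\<epsilon> / (2 * L\<^sup>2)\<close> of the exponent lies in this range
  exactly in the first case; in the second, \<open>t\<close> is the endpoint
  \<open>1 / b\<close>.\<close>

lemma deviation_lower_tail:
  assumes "5 \<le> K" "0 < \<epsilon>" "grouping n I ns" "p \<in> params K I ns"
  shows "prob {\<omega> \<in> space M. deviation n K I ns p z \<omega> \<le> - \<epsilon>}
    \<le> (if \<epsilon> \<le> 2 * (ln (real K))\<^sup>2 / b_star K
        then exp (- (real n * \<epsilon>\<^sup>2 / (4 * (ln (real K))\<^sup>2)))
        else exp (- (real n * \<epsilon> / (2 * b_star K))))"
proof -
  define L where "L = ln (real K)"
  have L: "L > 0" using assms by (simp add: L_def)
  define b where "b = b_star K"
  have b: "b > 0" using b_star_pos assms by (simp add: b_def)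
  have bound: "prob {\<omega> \<in> space M. deviation n K I ns p z \<omega> \<le> - \<epsilon>} \<le> exp (real n * ((t * L)\<^sup>2 - t * \<epsilon>))"
    if t: "0 < t" "t \<le> 1 / b" for t
  proof -
    have "prob {\<omega> \<in> space M. t * \<epsilon> \<le> - t * deviation n K I ns p z \<omega>} \<le> exp (real n * ((t * L)\<^sup>2 - t * \<epsilon>))"
      unfolding L_def
      by (intro chernoff_deviation assms sum_simplex_exp_rem_le_b_star t[unfolded b_def])
    also have "{\<omega> \<in> space M. t * \<epsilon> \<le> - t * deviation n K I ns p z \<omega>}
        = {\<omega> \<in> space M. deviation n K I ns p z \<omega> \<le> - \<epsilon>}"
      using mult_le_cancel_left_pos[OF t(1), of \<epsilon> "- deviation n K I ns p z \<omega>" for \<omega>]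
      by (intro Collect_cong) (smt (verit) mult_minus_left mult_minus_right)
    finally show ?thesis .
  qed
  show ?thesis
  proof (cases "\<epsilon> \<le> 2 * L\<^sup>2 / b")
    case True
    define t where "t = \<epsilon> / (2 * L\<^sup>2)"
    have "t > 0" "t \<le> 1 / b" using assms L b True by (auto simp: t_def field_simps)
    from bound[OF this] have "prob {\<omega> \<in> space M. deviation n K I ns p z \<omega> \<le> - \<epsilon>}
        \<le> exp (real n * ((t * L)\<^sup>2 - t * \<epsilon>))" .
    also have "(t * L)\<^sup>2 - t * \<epsilon> = - (\<epsilon>\<^sup>2 / (4 * L\<^sup>2))"
      using L by (simp add: t_def field_simps power2_eq_square)
    finally show ?thesis using True by (simp add: L_def b_def)
  next
    case False
    \<comment> \<open>At the endpoint the quadratic term is at most half the linear one.\<close>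
    have "L\<^sup>2 / b \<le> \<epsilon> / 2" using False b by (simp add: field_simps)
    then have "1 / b * (L\<^sup>2 / b) \<le> 1 / b * (\<epsilon> / 2)" using b by (intro mult_left_mono) auto
    then have "(1 / b * L)\<^sup>2 - 1 / b * \<epsilon> \<le> - (\<epsilon> / (2 * b))"
      by (simp add: power2_eq_square)
    then have "real n * ((1 / b * L)\<^sup>2 - 1 / b * \<epsilon>) \<le> real n * - (\<epsilon> / (2 * b))"
      by (intro mult_left_mono) auto
    with bound[of "1 / b"] b have "prob {\<omega> \<in> space M. deviation n K I ns p z \<omega> \<le> - \<epsilon>}
        \<le> exp (real n * - (\<epsilon> / (2 * b)))"
      by (smt (verit) exp_le_cancel_iff zero_less_divide_1_iff)
    then show ?thesis using False by (simp add: L_def b_def)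
  qed
qed

end

section \<open>Persistence of the deviation when the number of categories is large\<close>

definition coin :: "nat \<Rightarrow> real" where
  "coin k = (if k = 1 then 1 else - 1)"

definition half_uniform :: "nat \<Rightarrow> nat \<Rightarrow> real" where
  "half_uniform K k = (if k = 1 then 1 / 2 else 1 / (2 * (real K - 1)))"

text \<open>The categories other than the first share mass \<open>1 / 2\<close>, so expectations of
  functions of \<open>coin\<close> are those for a fair sign.\<close>

lemma sum_half_uniform:
  fixes g :: "real \<Rightarrow> 'b :: real_vector"
  assumes "K \<ge> 2"
  shows "(\<Sum>k=1..K. half_uniform K k *\<^sub>R g (coin k)) = (1 / 2) *\<^sub>R (g 1 + g (- 1))"
proof -
  have "(\<Sum>k=1..K. half_uniform K k *\<^sub>R g (coin k))
      = (1 / 2) *\<^sub>R g 1 + (\<Sum>k=Suc 1..K. (1 / (2 * (real K - 1))) *\<^sub>R g (- 1))"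
    using assms by (subst sum.atLeast_Suc_atMost) (auto simp: half_uniform_def coin_def intro!: sum.cong)
  also have "(\<Sum>k=Suc 1..K. (1 / (2 * (real K - 1))) *\<^sub>R g (- 1)) = (1 / 2) *\<^sub>R g (- 1)"
    using assms by (simp add: sum_constant_scaleR of_nat_diff)
  finally show ?thesis by (simp add: scaleR_add_right)
qed

lemma half_uniform_simplex:
  assumes "K \<ge> 2"
  shows "half_uniform K \<in> simplex_C K"
  using assms sum_half_uniform[OF assms, of "\<lambda>_. 1 :: real"]
  by (auto simp: simplex_C_def half_uniform_def field_simps)

text \<open>The two values \<open>- ln 2\<close> and \<open>- ln 2 - ln (K - 1)\<close> are written
  as midpoint plus half their distance times a sign, so that centring removes the midpoint.\<close>

lemma ln_half_uniform:
  assumes "K \<ge> 2"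
  shows "ln (half_uniform K k) = - ln 2 - ln (real K - 1) / 2 + ln (real K - 1) / 2 * coin k"
proof -
  have "ln (1 / (2 * (real K - 1))) = - (ln 2 + ln (real K - 1))"
    using assms by (simp add: ln_div ln_mult del: right_diff_distrib_numeral)
  then show ?thesis by (simp add: half_uniform_def coin_def ln_div)
qed

lemma p_bar_const:
  assumes "grouping n I ns" "i \<in> {1..I}"
  shows "p_bar ns (\<lambda>_ _. q) i k = q k"
  using assms by (force simp: p_bar_def grouping_def)

text \<open>The density is positive everywhere, so null sets of the normal distribution are Lebesgue
  null, and the ray beyond \<open>c\<close> is not. Having a density also excludes atoms.\<close>

lemma cdf_std_normal_less_1: "cdf std_normal_distribution c < 1"
  and isCont_cdf_std_normal: "isCont (cdf std_normal_distribution) c"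
proof -
  interpret N: real_distribution std_normal_distribution
    by (rule real_dist_normal_dist)
  have null: "A \<in> null_sets lborel" if "A \<in> null_sets std_normal_distribution" for A
  proof -
    have "A \<in> sets lborel" "AE x in lborel. x \<in> A \<longrightarrow> ennreal (std_normal_density x) = 0"
      using that by (simp_all add: null_sets_density_iff)
    then show ?thesis
      by (subst AE_iff_null_sets) (auto simp: normal_density_def elim!: eventually_mono)
  qed
  have "N.prob {c<..} \<noteq> 0"
  proof
    assume "N.prob {c<..} = 0"
    then have "{c<..} \<in> null_sets lborel"
      by (intro null null_setsI) (auto simp: N.emeasure_eq_measure)
    then have "{c<..<c+1} \<in> null_sets lborel"
      by (rule null_sets_subset) auto
    then show False by (simp add: null_sets_def)
  qed
  moreover have "N.prob {c<..} = 1 - cdf std_normal_distribution c"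
    using N.prob_compl[of "{..c}"] by (simp add: cdf_def Compl_eq_Diff_UNIV[symmetric])
  ultimately show "cdf std_normal_distribution c < 1"
    using measure_nonneg[of std_normal_distribution "{c<..}"] by linarith
  have "{c} \<in> null_sets lborel" by (simp add: null_sets_def)
  then have "AE x in lborel. x \<notin> {c}" by (rule AE_not_in)
  then have "AE x in lborel. x \<in> {c} \<longrightarrow> ennreal (std_normal_density x) = 0"
    by (rule eventually_mono) auto
  then have "{c} \<in> null_sets std_normal_distribution"
    by (simp add: null_sets_density_iff)
  then have "N.prob {c} = 0" by (simp add: null_sets_def measure_def)
  then show "isCont (cdf std_normal_distribution) c" by (simp add: N.isCont_cdf)
qed

text \<open>The central limit theorem for fair signs, in terms of characteristic functions.\<close>

lemma cos_power_tendsto_normal_char: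
  "(\<lambda>n. cos (t / sqrt (real (Suc n))) ^ Suc n) \<longlonglongrightarrow> exp (- (t\<^sup>2) / 2)"
  unfolding power2_eq_square minus_divide_left[symmetric] by real_asymp

section \<open>The deviation as a normalised sum of signs\<close>

context categorical_sample
begin

definition coin_sum :: "nat \<Rightarrow> 'w \<Rightarrow> real" where
  "coin_sum n \<omega> = (\<Sum>x\<in>members. score (\<lambda>_ k. coin k / sqrt n) x \<omega>)"

text \<open>Exactly one entry of \<open>z\<close> is 1, so the score is the weight of the category
  drawn and a constant passes through unchanged.\<close>

lemma score_affine:
  assumes "x \<in> members" "\<omega> \<in> space M"
  shows "score (\<lambda>i k. c + d * a i k) x \<omega> = c + d * score a x \<omega>"
proof -
  obtain k where k: "k \<in> {1..K}" "z (fst x) (snd x) k \<omega> = 1"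
    "\<And>l. l \<in> {1..K} - {k} \<Longrightarrow> z (fst x) (snd x) l \<omega> = 0"
    using one_hot[of "fst x" "snd x" \<omega>] assms by auto
  have "score a x \<omega> = a (fst x) k" for a
  proof -
    have "score a x \<omega> = (\<Sum>l=1..K. if l = k then a (fst x) l else 0)"
      unfolding score_def using k by (intro sum.cong) auto
    then show ?thesis using k(1) by simp
  qed
  then show ?thesis by simp
qed

lemma coin_sum_measurable [measurable]: "coin_sum n \<in> borel_measurable M"
  unfolding coin_sum_def using indep_score by (intro borel_measurable_sum) (auto simp: indep_vars_def2)

lemma deviation_half_uniform:
  assumes p: "p = (\<lambda>_ _. half_uniform K)" and K: "K \<ge> 2" and grouping: "grouping n I ns"
    and \<omega>: "\<omega> \<in> space M"
  shows "deviation n K I ns p z \<omega> = ln (real K - 1) / (2 * sqrt n) * coin_sum n \<omega>"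
proof -
  define d where "d = ln (real K - 1) / 2"
  define c where "c = - ln 2 - d"
  have n: "n > 0" by (rule grouping_pos[OF grouping])
  \<comment> \<open>The factors \<open>1 *\<close> match \<open>deviation_eq_sum_score\<close> at
    \<open>t = 1\<close>. The constant \<open>c\<close> is also the mean and cancels.\<close>
  have term_eq: "score (\<lambda>i k. 1 * ln (p_bar ns p i k)) x \<omega>
      - (\<Sum>k=1..K. p (fst x) (snd x) k * (1 * ln (p_bar ns p (fst x) k)))
      = d * sqrt n * score (\<lambda>_ k. coin k / sqrt n) x \<omega>" if x: "x \<in> members" for x
  proof -
    have pb: "ln (p_bar ns p (fst x) k) = c + d * coin k" for k
      using x K p_bar_const[OF grouping, of "fst x" "half_uniform K"]
      by (auto simp: p ln_half_uniform c_def d_def)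
    have "score (\<lambda>i k. 1 * ln (p_bar ns p i k)) x \<omega>
        = score (\<lambda>i k. c + d * sqrt n * (coin k / sqrt n)) x \<omega>"
      using n by (simp add: score_def pb)
    also have "\<dots> = c + d * sqrt n * score (\<lambda>_ k. coin k / sqrt n) x \<omega>"
      by (rule score_affine[OF x \<omega>])
    moreover have "(\<Sum>k=1..K. p (fst x) (snd x) k * (1 * ln (p_bar ns p (fst x) k))) = c"
      using sum_half_uniform[OF K, of "\<lambda>y. c + d * y"] unfolding pb by (simp add: p)
    ultimately show ?thesis by simp
  qed
  have "1 * deviation n K I ns p z \<omega> * n = d * sqrt n * coin_sum n \<omega>"
    unfolding deviation_eq_sum_score[OF n] coin_sum_def sum_distrib_left by (rule sum.cong[OF refl term_eq])
  then have "deviation n K I ns p z \<omega> = d * (sqrt n / n) * coin_sum n \<omega>"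
    using n by (simp add: field_simps)
  also have "sqrt n / n = 1 / sqrt n" by (simp add: sqrt_divide_self_eq inverse_eq_divide)
  finally show ?thesis by (simp add: d_def)
qed

text \<open>Each summand is a fair sign over \<open>sqrt n\<close>, and independence multiplies the
  \<open>n\<close> equal factors.\<close>

lemma char_coin_sum:
  assumes p: "p = (\<lambda>_ _. half_uniform K)" and K: "K \<ge> 2" and grouping: "grouping n I ns"
  shows "char (distr M borel (coin_sum n)) t = complex_of_real (cos (t / sqrt n) ^ n)"
proof -
  define a where "a = (\<lambda>(_::nat) k. coin k / sqrt n)"
  have "char (distr M borel (score a x)) t = complex_of_real (cos (t / sqrt n))" if x: "x \<in> members" for x
  proof -
    have [measurable]: "score a x \<in> borel_measurable M"
      using indep_score x by (auto simp: indep_vars_def2)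
    have "char (distr M borel (score a x)) t = (LINT \<omega>|M. iexp (t * score a x \<omega>))"
      unfolding char_def by (subst integral_distr) auto
    also have "\<dots> = (\<Sum>k=1..K. half_uniform K k *\<^sub>R iexp (t * (coin k / sqrt n)))"
      using expectation_score[OF x, of "\<lambda>y. iexp (t * y)" a] by (simp add: p a_def)
    also have "\<dots> = (1 / 2) *\<^sub>R (iexp (t / sqrt n) + iexp (- (t / sqrt n)))"
      by (subst sum_half_uniform[OF K, of "\<lambda>y. iexp (t * (y / sqrt n))"]) simp
    also have "\<dots> = complex_of_real (cos (t / sqrt n))"
      by (simp add: complex_eq_iff Re_exp Im_exp)
    finally show ?thesis .
  qed
  then have "char (distr M borel (coin_sum n)) t = (\<Prod>x\<in>members. complex_of_real (cos (t / sqrt n)))"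
    unfolding coin_sum_def[abs_def] a_def[symmetric] by (subst char_distr_sum[OF indep_score]) simp
  also have "\<dots> = complex_of_real (cos (t / sqrt n) ^ n)"
    using grouping by (simp add: grouping_def)
  finally show ?thesis .
qed

end

text \<open>
  For \<open>p = half_uniform K\<close> the deviation is \<open>ln (K - 1) / (2 * sqrt n)\<close> times a normalised sum of
  fair signs, which converges weakly to a standard normal variable; the factor stays bounded
  away from 0.
\<close>
lemma deviation_not_tendsto_0:
  fixes M :: "nat \<Rightarrow> (nat \<Rightarrow> nat \<Rightarrow> nat \<Rightarrow> real) \<Rightarrow> 'w measure"
    and z :: "nat \<Rightarrow> (nat \<Rightarrow> nat \<Rightarrow> nat \<Rightarrow> real) \<Rightarrow> nat \<Rightarrow> nat \<Rightarrow> nat \<Rightarrow> 'w \<Rightarrow> real"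
  assumes K: "\<And>n. n \<ge> 1 \<Longrightarrow> 2 \<le> K n" and grouping: "\<And>n. n \<ge> 1 \<Longrightarrow> grouping n (I n) (ns n)"
    and sample: "\<And>n p. n \<ge> 1 \<Longrightarrow> p \<in> params (K n) (I n) (ns n) \<Longrightarrow>
      categorical_sample (M n p) (K n) (I n) (ns n) p (z n p)"
    and Omega: "(\<lambda>n. (ln (real (K n)))\<^sup>2 / real n) \<in> \<Omega>(\<lambda>_. 1)" and \<epsilon>: "\<epsilon> > 0"
  shows "\<not> (\<lambda>n. SUP p \<in> params (K n) (I n) (ns n). measure (M n p)
    {\<omega> \<in> space (M n p). \<bar>deviation n (K n) (I n) (ns n) p (z n p) \<omega>\<bar> \<ge> \<epsilon>}) \<longlonglongrightarrow> 0"
    (is "\<not> ?sup \<longlonglongrightarrow> 0")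
proof
  assume lim: "?sup \<longlonglongrightarrow> 0"
  obtain c where c: "c > 0" "\<forall>\<^sub>F n in sequentially. c \<le> (ln (real (K n)))\<^sup>2 / real n"
    using Omega by (auto elim!: landau_omega.bigE)
  \<comment> \<open>Eventually the factor in front of \<open>T n\<close> is at least
    \<open>sqrt c / 4\<close>, so \<open>T n > C\<close> forces a deviation of at least
    \<open>\<epsilon>\<close>.\<close>
  define C where "C = 4 * \<epsilon> / sqrt c"
  define p where "p = (\<lambda>n (_::nat) (_::nat). half_uniform (K n))"
  have p: "p n \<in> params (K n) (I n) (ns n)" if "n \<ge> 1" for n
    using half_uniform_simplex[OF K[OF that]] by (simp add: p_def params_def)
  note smp = sample[OF _ p]
  define T where "T = (\<lambda>n. categorical_sample.coin_sum (K n) (I n) (ns n) (z n (p n)) n)"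
  define \<mu> where "\<mu> = (\<lambda>n. distr (M n (p n)) borel (T n))"
  have \<mu>: "real_distribution (\<mu> n)" "char (\<mu> n) t = complex_of_real (cos (t / sqrt n) ^ n)"
    if n: "n \<ge> 1" for n t
  proof -
    interpret categorical_sample "M n (p n)" "K n" "I n" "ns n" "p n" "z n (p n)"
      by (rule smp[OF n n])
    show "real_distribution (\<mu> n)"
      unfolding \<mu>_def T_def by (rule real_distribution_distr[OF coin_sum_measurable])
    show "char (\<mu> n) t = complex_of_real (cos (t / sqrt n) ^ n)"
      unfolding \<mu>_def T_def by (rule char_coin_sum[OF _ K[OF n] grouping[OF n]]) (simp add: p_def)
  qed
  \<comment> \<open>The shift to \<open>Suc n\<close> is due to the samples being given only for
    \<open>n \<ge> 1\<close>, while Levy continuity asks for a distribution at every index.\<close>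
  have "weak_conv_m (\<lambda>n. \<mu> (Suc n)) std_normal_distribution"
  proof (rule levy_continuity)
    fix t
    show "(\<lambda>n. char (\<mu> (Suc n)) t) \<longlonglongrightarrow> char std_normal_distribution t"
      using tendsto_of_real[OF cos_power_tendsto_normal_char[of t], where ?'a = complex]
      by (simp only: \<mu>(2) char_std_normal_distribution le_add1 plus_1_eq_Suc[symmetric])
  qed (simp_all add: \<mu>(1) real_dist_normal_dist)
  then have "(\<lambda>n. cdf (\<mu> (Suc n)) C) \<longlonglongrightarrow> cdf std_normal_distribution C"
    using isCont_cdf_std_normal by (simp add: weak_conv_m_def weak_conv_def)
  then have lim': "(\<lambda>n. 1 - cdf (\<mu> (Suc n)) C) \<longlonglongrightarrow> 1 - cdf std_normal_distribution C"
    by (intro tendsto_intros)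
  \<comment> \<open>With \<open>sqrt (c * n) \<le> ln K\<close> this gives
    \<open>ln 2 \<le> ln K / 2\<close>, hence
    \<open>ln K / 2 \<le> ln (K / 2) \<le> ln (K - 1)\<close>.\<close>
  have "\<forall>\<^sub>F n in sequentially. 2 * ln 2 \<le> sqrt (c * real n)"
    using c(1) by real_asymp
  with c(2) have "\<forall>\<^sub>F n in sequentially. n \<ge> 1 \<longrightarrow> 1 - cdf (\<mu> n) C \<le> ?sup n"
  proof eventually_elim
    case (elim n)
    show ?case
    proof
      assume n: "n \<ge> 1"
      interpret categorical_sample "M n (p n)" "K n" "I n" "ns n" "p n" "z n (p n)"
        by (rule smp[OF n n])
      have T [measurable]: "T n \<in> borel_measurable (M n (p n))"
        unfolding T_def by measurable
      have Kn: "2 \<le> K n" by (rule K[OF n])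
      define d where "d = ln (real (K n) - 1) / (2 * sqrt n)"
      have "sqrt (c * n) \<le> sqrt ((ln (real (K n)))\<^sup>2)"
        using elim(1) n by (intro real_sqrt_le_mono) (simp add: field_simps)
      then have lnK: "sqrt (c * n) \<le> ln (real (K n))" using Kn by simp
      have "ln (real (K n) / 2) \<le> ln (real (K n) - 1)"
        using Kn by (subst ln_le_cancel_iff) auto
      then have "ln (real (K n)) / 2 \<le> ln (real (K n) - 1)"
        using Kn lnK elim(2) by (simp add: ln_div)
      with lnK have "sqrt c * sqrt n / 2 \<le> ln (real (K n) - 1)"
        by (simp add: real_sqrt_mult)
      then have d: "sqrt c / 4 \<le> d"
        using n by (simp add: d_def field_simps)
      have "1 - cdf (\<mu> n) C = prob (space (M n (p n)) - {\<omega> \<in> space (M n (p n)). T n \<omega> \<le> C})"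
        by (subst prob_compl, measurable) (auto simp: \<mu>_def cdf_def measure_distr vimage_def Int_def conj_commute)
      also have "\<dots> \<le> prob {\<omega> \<in> space (M n (p n)). \<bar>d * T n \<omega>\<bar> \<ge> \<epsilon>}"
      proof (rule finite_measure_mono)
        show "space (M n (p n)) - {\<omega> \<in> space (M n (p n)). T n \<omega> \<le> C}
            \<subseteq> {\<omega> \<in> space (M n (p n)). \<bar>d * T n \<omega>\<bar> \<ge> \<epsilon>}"
        proof safe
          fix \<omega> assume "\<not> T n \<omega> \<le> C"
          then have "sqrt c / 4 * C \<le> d * T n \<omega>"
            using d c(1) \<epsilon> by (intro mult_mono) (auto simp: C_def intro: order_trans[of 0 "sqrt c / 4"])
          moreover have "sqrt c / 4 * C = \<epsilon>" using c(1) by (simp add: C_def)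
          ultimately show "\<epsilon> \<le> \<bar>d * T n \<omega>\<bar>" by linarith
        qed
      qed measurable
      also have "{\<omega> \<in> space (M n (p n)). \<bar>d * T n \<omega>\<bar> \<ge> \<epsilon>}
          = {\<omega> \<in> space (M n (p n)). \<bar>deviation n (K n) (I n) (ns n) (p n) (z n (p n)) \<omega>\<bar> \<ge> \<epsilon>}"
        using deviation_half_uniform[OF _ Kn grouping[OF n]]
        by (intro Collect_cong conj_cong refl) (simp add: p_def d_def T_def)
      also have "prob \<dots> \<le> ?sup n"
      proof (rule cSUP_upper[OF p[OF n]])
        \<comment> \<open>A real supremum dominates its members only for a bounded family;
          probabilities are bounded by 1.\<close>
        show "bdd_above ((\<lambda>p. measure (M n p) {\<omega> \<in> space (M n p).
            \<bar>deviation n (K n) (I n) (ns n) p (z n p) \<omega>\<bar> \<ge> \<epsilon>}) ` params (K n) (I n) (ns n))"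
          using sample[OF n] by (intro bdd_aboveI2[of _ _ 1])
            (auto simp: categorical_sample_def intro: prob_space.prob_le_1)
      qed
      finally show "1 - cdf (\<mu> n) C \<le> ?sup n" .
    qed
  qed
  then have "\<forall>\<^sub>F n in sequentially. 1 - cdf (\<mu> (Suc n)) C \<le> ?sup (Suc n)"
    by (subst (asm) eventually_sequentially_Suc[symmetric]) simp
  from tendsto_le[OF _ LIMSEQ_Suc[OF lim] lim' this] have "1 - cdf std_normal_distribution C \<le> 0"
    by simp
  with cdf_std_normal_less_1[of C] show False by linarith
qed

theorem theorem10:
  shows
    "(\<forall>(K::nat) (I::nat) (ns::nat \<Rightarrow> nat) (n::nat) (\<epsilon>::real)
        (M :: (nat \<Rightarrow> nat \<Rightarrow> nat \<Rightarrow> real) \<Rightarrow> 'w measure)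
        (z :: (nat \<Rightarrow> nat \<Rightarrow> nat \<Rightarrow> real) \<Rightarrow> nat \<Rightarrow> nat \<Rightarrow> nat \<Rightarrow> 'w \<Rightarrow> real).
        5 \<le> K \<longrightarrow> 0 < \<epsilon> \<longrightarrow> grouping n I ns \<longrightarrow>
        (\<forall>p \<in> params K I ns. categorical_sample (M p) K I ns p (z p)) \<longrightarrow>
        (SUP p \<in> params K I ns.
           measure (M p) {\<omega> \<in> space (M p). deviation n K I ns p (z p) \<omega> \<ge> \<epsilon>})
          \<le> exp (- (real n * \<epsilon>\<^sup>2 / (4 * (ln (real K))\<^sup>2))))
   \<and> (\<forall>(K::nat) (I::nat) (ns::nat \<Rightarrow> nat) (n::nat) (\<epsilon>::real)
        (M :: (nat \<Rightarrow> nat \<Rightarrow> nat \<Rightarrow> real) \<Rightarrow> 'w measure)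
        (z :: (nat \<Rightarrow> nat \<Rightarrow> nat \<Rightarrow> real) \<Rightarrow> nat \<Rightarrow> nat \<Rightarrow> nat \<Rightarrow> 'w \<Rightarrow> real).
        5 \<le> K \<longrightarrow> 0 < \<epsilon> \<longrightarrow> grouping n I ns \<longrightarrow>
        (\<forall>p \<in> params K I ns. categorical_sample (M p) K I ns p (z p)) \<longrightarrow>
        (SUP p \<in> params K I ns.
           measure (M p) {\<omega> \<in> space (M p). deviation n K I ns p (z p) \<omega> \<le> - \<epsilon>})
          \<le> (if \<epsilon> \<le> 2 * (ln (real K))\<^sup>2 / b_star K
              then exp (- (real n * \<epsilon>\<^sup>2 / (4 * (ln (real K))\<^sup>2)))
              else exp (- (real n * \<epsilon> / (2 * b_star K)))))
   \<and> (\<forall>(K::nat \<Rightarrow> nat) (I::nat \<Rightarrow> nat) (ns::nat \<Rightarrow> nat \<Rightarrow> nat)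
        (M :: nat \<Rightarrow> (nat \<Rightarrow> nat \<Rightarrow> nat \<Rightarrow> real) \<Rightarrow> 'w measure)
        (z :: nat \<Rightarrow> (nat \<Rightarrow> nat \<Rightarrow> nat \<Rightarrow> real) \<Rightarrow> nat \<Rightarrow> nat \<Rightarrow> nat \<Rightarrow> 'w \<Rightarrow> real).
        (\<forall>n\<ge>1. 2 \<le> K n \<and> grouping n (I n) (ns n)) \<longrightarrow>
        (\<forall>n\<ge>1. \<forall>p \<in> params (K n) (I n) (ns n).
            categorical_sample (M n p) (K n) (I n) (ns n) p (z n p)) \<longrightarrow>
        (\<lambda>n. (ln (real (K n)))\<^sup>2 / real n) \<in> \<Omega>(\<lambda>_. 1) \<longrightarrow>
        (\<forall>\<epsilon>>0. \<not> (\<lambda>n. SUP p \<in> params (K n) (I n) (ns n).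
            measure (M n p) {\<omega> \<in> space (M n p).
              \<bar>deviation n (K n) (I n) (ns n) p (z n p) \<omega>\<bar> \<ge> \<epsilon>}) \<longlonglongrightarrow> 0))"
proof (intro conjI allI impI)
  fix K I n :: nat and ns :: "nat \<Rightarrow> nat" and \<epsilon> :: real
    and M :: "(nat \<Rightarrow> nat \<Rightarrow> nat \<Rightarrow> real) \<Rightarrow> 'w measure" and z
  assume *: "5 \<le> K" "0 < \<epsilon>" "grouping n I ns"
    "\<forall>p \<in> params K I ns. categorical_sample (M p) K I ns p (z p)"
  show "(SUP p \<in> params K I ns.
      measure (M p) {\<omega> \<in> space (M p). deviation n K I ns p (z p) \<omega> \<ge> \<epsilon>})
    \<le> exp (- (real n * \<epsilon>\<^sup>2 / (4 * (ln (real K))\<^sup>2)))"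
    using * by (intro cSUP_least params_nonempty categorical_sample.deviation_upper_tail) auto
next
  fix K I n :: nat and ns :: "nat \<Rightarrow> nat" and \<epsilon> :: real
    and M :: "(nat \<Rightarrow> nat \<Rightarrow> nat \<Rightarrow> real) \<Rightarrow> 'w measure" and z
  assume *: "5 \<le> K" "0 < \<epsilon>" "grouping n I ns"
    "\<forall>p \<in> params K I ns. categorical_sample (M p) K I ns p (z p)"
  show "(SUP p \<in> params K I ns.
      measure (M p) {\<omega> \<in> space (M p). deviation n K I ns p (z p) \<omega> \<le> - \<epsilon>})
    \<le> (if \<epsilon> \<le> 2 * (ln (real K))\<^sup>2 / b_star K
        then exp (- (real n * \<epsilon>\<^sup>2 / (4 * (ln (real K))\<^sup>2)))
        else exp (- (real n * \<epsilon> / (2 * b_star K))))"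
    using * by (intro cSUP_least params_nonempty categorical_sample.deviation_lower_tail) auto
next
  fix K I :: "nat \<Rightarrow> nat" and ns :: "nat \<Rightarrow> nat \<Rightarrow> nat" and \<epsilon> :: real
    and M :: "nat \<Rightarrow> (nat \<Rightarrow> nat \<Rightarrow> nat \<Rightarrow> real) \<Rightarrow> 'w measure" and z
  assume "\<forall>n\<ge>1. 2 \<le> K n \<and> grouping n (I n) (ns n)"
    "\<forall>n\<ge>1. \<forall>p \<in> params (K n) (I n) (ns n).
       categorical_sample (M n p) (K n) (I n) (ns n) p (z n p)"
    "(\<lambda>n. (ln (real (K n)))\<^sup>2 / real n) \<in> \<Omega>(\<lambda>_. 1)" "0 < \<epsilon>"
  then show "\<not> (\<lambda>n. SUP p \<in> params (K n) (I n) (ns n).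
      measure (M n p) {\<omega> \<in> space (M n p).
        \<bar>deviation n (K n) (I n) (ns n) p (z n p) \<omega>\<bar> \<ge> \<epsilon>}) \<longlonglongrightarrow> 0"
    by (intro deviation_not_tendsto_0) auto
qed

end
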